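(* Let $L$ be a modular lattice of finite length and let $T$ be a doubling tolerance on $L$. Then $[L\ast_2 T]=(L\times\mathsf C_2;\rho)$ is also a modular lattice of finite length. If, in addition, $L$ is distributive, then $[L\ast_2 T]$ is distributive, too.
   Context: A lattice is of finite length if there is a natural number $n$ such that no chain in it has more than $n+1$ elements. A tolerance on a lattice $L$ is a reflexive and symmetric binary relation $T$ on $L$ that is compatible with (preserved by) both lattice operations: if $(a_1,b_1),(a_2,b_2)\in T$, then $(a_1\vee a_2,b_1\vee b_2)\in T$ and $(a_1\wedge a_2,b_1\wedge b_2)\in T$. The blocks of $T$ are the maximal subsets $X$ of $L$ such that $X\times X\subseteq T$ (in a lattice of finite length, they are known to be intervals). A doubling tolerance on a modular lattice $L$ of finite length is a tolerance $T$ on $L$ such that every block of $T$ has at most two elements (equivalently, each block $[a,b]$ satisfies $a=b$ or $a\prec b$, where $\prec$ is the covering relation). For a doubling tolerance $T$ on $L$, write $a\prec_T b$ if $[a,b]$ is a two-element block of $T$; equivalently, if $(a,b)\in T$ and $a<b$. Let $\mathsf C_2=\{0,1\}$ be the two-element chain with $0\prec 1$. On the set $L\times\mathsf C_2$ define: $\pi$ is the direct product order, that is, $((a,i),(b,j))\in\pi$ iff $a\le b$ in $L$ and $i\le j$ in $\mathsf C_2$; and $((a,i),(b,j))\in\tau$ iff $i=1$, $j=0$, and $a\prec_T b$. Let $\rho$ be the transitive closure of $\pi\cup\tau$. The structure $(L\times\mathsf C_2;\rho)$ is denoted by $[L\ast_2 T]$; to say that it is a lattice means that $\rho$ is a partial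 order on $L\times\mathsf C_2$ that is a lattice order. *)

theory Defs
  imports "HOL-Algebra.Lattice"
begin

locale modular_lattice = lattice +
  assumes modular:
    "\<lbrakk>x \<in> carrier L; y \<in> carrier L; z \<in> carrier L; x \<sqsubseteq> z\<rbrakk>
      \<Longrightarrow> x \<squnion> (y \<sqinter> z) = (x \<squnion> y) \<sqinter> z"

locale distributive_lattice = lattice +
  assumes distributive:
    "\<lbrakk>x \<in> carrier L; y \<in> carrier L; z \<in> carrier L\<rbrakk>
      \<Longrightarrow> x \<sqinter> (y \<squnion> z) = (x \<sqinter> y) \<squnion> (x \<sqinter> z)"

definition finite_length :: "('a, 'm) gorder_scheme \<Rightarrow> bool" where
  "finite_length L \<longleftrightarrow>
    (\<exists>n::nat. \<forall>C \<subseteq> carrier L.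
      Complete_Partial_Order.chain (le L) C \<longrightarrow> finite C \<and> card C \<le> n + 1)"

definition tolerance :: "('a, 'm) gorder_scheme \<Rightarrow> ('a \<times> 'a) set \<Rightarrow> bool" where
  "tolerance L T \<longleftrightarrow>
    T \<subseteq> carrier L \<times> carrier L \<and> refl_on (carrier L) T \<and> sym T \<and>
    (\<forall>a\<^sub>1 b\<^sub>1 a\<^sub>2 b\<^sub>2. (a\<^sub>1, b\<^sub>1) \<in> T \<and> (a\<^sub>2, b\<^sub>2) \<in> T \<longrightarrow>
      (a\<^sub>1 \<squnion>\<^bsub>L\<^esub> a\<^sub>2, b\<^sub>1 \<squnion>\<^bsub>L\<^esub> b\<^sub>2) \<in> T \<and> (a\<^sub>1 \<sqinter>\<^bsub>L\<^esub> a\<^sub>2, b\<^sub>1 \<sqinter>\<^bsub>L\<^esub> b\<^sub>2) \<in> T)"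

definition blocks :: "('a, 'm) gorder_scheme \<Rightarrow> ('a \<times> 'a) set \<Rightarrow> 'a set set" where
  "blocks L T =
    {X. X \<subseteq> carrier L \<and> X \<times> X \<subseteq> T \<and>
      (\<forall>Y. Y \<subseteq> carrier L \<and> Y \<times> Y \<subseteq> T \<and> X \<subseteq> Y \<longrightarrow> Y = X)}"

definition doubling_tolerance :: "('a, 'm) gorder_scheme \<Rightarrow> ('a \<times> 'a) set \<Rightarrow> bool" where
  "doubling_tolerance L T \<longleftrightarrow>
    tolerance L T \<and> (\<forall>X \<in> blocks L T. finite X \<and> card X \<le> 2)"

text \<open>The relation \<open>a \<prec>\<^sub>T b\<close>. The interval from \<open>a\<close> to \<open>b\<close> is empty unless \<open>a\<close> is below \<open>b\<close>,
  so having two elements forces \<open>a \<noteq> b\<close> and \<open>a\<close> below \<open>b\<close>.\<close>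

definition block_cover :: "('a, 'm) gorder_scheme \<Rightarrow> ('a \<times> 'a) set \<Rightarrow> 'a \<Rightarrow> 'a \<Rightarrow> bool" where
  "block_cover L T a b \<longleftrightarrow>
    a \<in> carrier L \<and> b \<in> carrier L \<and> \<lbrace>a..b\<rbrace>\<^bsub>L\<^esub> \<in> blocks L T \<and> card \<lbrace>a..b\<rbrace>\<^bsub>L\<^esub> = 2"

text \<open>The two-element chain is \<open>{0, 1}\<close> with the order of \<open>nat\<close>.\<close>

definition pi_rel :: "('a, 'm) gorder_scheme \<Rightarrow> (('a \<times> nat) \<times> ('a \<times> nat)) set" where
  "pi_rel L =
    {((a, i), (b, j)) | a i b j.
      a \<in> carrier L \<and> b \<in> carrier L \<and> i \<in> {0, 1} \<and> j \<in> {0, 1} \<and> a \<sqsubseteq>\<^bsub>L\<^esub> b \<and> i \<le> j}"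

definition tau_rel ::
  "('a, 'm) gorder_scheme \<Rightarrow> ('a \<times> 'a) set \<Rightarrow> (('a \<times> nat) \<times> ('a \<times> nat)) set" where
  "tau_rel L T = {((a, i), (b, j)) | a i b j. i = 1 \<and> j = 0 \<and> block_cover L T a b}"

definition rho_rel ::
  "('a, 'm) gorder_scheme \<Rightarrow> ('a \<times> 'a) set \<Rightarrow> (('a \<times> nat) \<times> ('a \<times> nat)) set" where
  "rho_rel L T = (pi_rel L \<union> tau_rel L T)\<^sup>+"

text \<open>The structure \<open>[L *\<^sub>2 T]\<close>. No order property of \<open>rho_rel\<close> is built in; the field \<open>eq\<close> is
  plain equality, as the locale \<open>lattice\<close> requires.\<close>

definition doubled ::
  "('a, 'm) gorder_scheme \<Rightarrow> ('a \<times> 'a) set \<Rightarrow> ('a \<times> nat) gorder" where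
  "doubled L T =
    \<lparr>carrier = carrier L \<times> {0, 1}, eq = (=), le = (\<lambda>x y. (x, y) \<in> rho_rel L T)\<rparr>"

end

theory Submission
  imports Defs
begin

text \<open>
  Everything rests on one property of a doubling tolerance on a modular lattice: the pairs
  \<open>a \<prec>\<^sub>T b\<close> are closed under componentwise joins and meets (\<open>block_cover_join\<close>). Joining two such
  pairs gives a pair in \<open>T\<close>; if its components were equal, modularity would force the interval
  between the meets of the two pairs, which lies in a single block, to contain at least three
  elements.

  The order \<open>\<rho>\<close> compares first components, and in addition \<open>(a, 1)\<close> lies below \<open>(b, 0)\<close> exactly
  when a pair \<open>c \<prec>\<^sub>T d\<close> fits between \<open>a\<close> and \<open>b\<close> (\<open>rho_rel_iff\<close>); the predicate \<open>ascends\<close> expresses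
  this. By the closure property, the elements that ascend to a fixed \<open>x\<close> are closed under joins
  (\<open>ascends_join\<close>); together with \<open>ascends_split\<close>, this shows that the join of \<open>(a, i)\<close> and
  \<open>(b, j)\<close> is \<open>(a \<squnion> b, 0)\<close> if that is an upper bound of them, and \<open>(a \<squnion> b, 1)\<close> otherwise. Meets come from duality: doubling the dual lattice and exchanging
  the two layers gives the dual of the doubled lattice.

  Modularity and distributivity are both treated as cancellation laws: \<open>x \<squnion> y = z \<squnion> y\<close> and
  \<open>x \<sqinter> y = z \<sqinter> y\<close> imply \<open>x = z\<close>, for comparable \<open>x\<close>, \<open>z\<close> in the modular case and for all \<open>x\<close>, \<open>z\<close>
  in the distributive case. The first projection is a lattice homomorphism onto \<open>L\<close>, so in both
  cases cancellation in \<open>L\<close> leaves only two elements of one fibre \<open>{(x, 0), (x, 1)}\<close> to be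
  separated. There it follows from two facts on ascending: it is invariant under transposing an
  interval (\<open>ascends_transpose_up\<close> and its dual), and \<open>x\<close> and \<open>y\<close> never both ascend to \<open>x \<squnion> y\<close>
  (\<open>not_ascends_both\<close>).
\<close>

section \<open>Modularity and distributivity as cancellation laws\<close>

lemma (in lattice) join_mono:
  assumes "a \<sqsubseteq> b" "c \<sqsubseteq> d"
    and "a \<in> carrier L" "b \<in> carrier L" "c \<in> carrier L" "d \<in> carrier L"
  shows "a \<squnion> c \<sqsubseteq> b \<squnion> d"
  using assms
  by (intro join_le) (auto intro: le_trans[OF _ join_left] le_trans[OF _ join_right])

lemma (in lattice) meet_mono:
  assumes "a \<sqsubseteq> b" "c \<sqsubseteq> d"
    and "a \<in> carrier L" "b \<in> carrier L" "c \<in> carrier L" "d \<in> carrier L"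
  shows "a \<sqinter> c \<sqsubseteq> b \<sqinter> d"
  using assms
  by (intro meet_le) (auto intro: le_trans[OF meet_left] le_trans[OF meet_right])

lemma (in lattice) join_absorb: "\<lbrakk>a \<sqsubseteq> b; a \<in> carrier L; b \<in> carrier L\<rbrakk> \<Longrightarrow> a \<squnion> b = b"
  by (meson join_closed join_le join_right le_antisym le_refl)

lemma (in lattice) meet_absorb: "\<lbrakk>a \<sqsubseteq> b; a \<in> carrier L; b \<in> carrier L\<rbrakk> \<Longrightarrow> a \<sqinter> b = a"
  by (meson le_antisym le_refl meet_closed meet_le meet_left)

lemma (in modular_lattice) modular_cancel:
  assumes "x \<in> carrier L" "y \<in> carrier L" "z \<in> carrier L" "x \<sqsubseteq> z"
    and "x \<squnion> y = z \<squnion> y" "x \<sqinter> y = z \<sqinter> y"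
  shows "x = z"
proof -
  have "x = x \<squnion> (y \<sqinter> z)"
    using assms by (metis join_le join_left le_antisym le_refl meet_closed meet_left join_closed meet_comm)
  also have "\<dots> = (x \<squnion> y) \<sqinter> z"
    using assms modular by blast
  also have "\<dots> = z"
    using assms by (metis join_closed join_left le_antisym le_refl meet_closed meet_le meet_right)
  finally show ?thesis .
qed

text \<open>
  The two sides of the modular law are comparable, and they have the same join and the same meet
  with \<open>y\<close>.
\<close>

lemma (in lattice) modular_latticeI:
  assumes cancel: "\<And>x y z. \<lbrakk>x \<in> carrier L; y \<in> carrier L; z \<in> carrier L; x \<sqsubseteq> z;
    x \<squnion> y = z \<squnion> y; x \<sqinter> y = z \<sqinter> y\<rbrakk> \<Longrightarrow> x = z"
  shows "modular_lattice L"
proof unfold_locales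
  fix x y z assume c: "x \<in> carrier L" "y \<in> carrier L" "z \<in> carrier L" and xz: "x \<sqsubseteq> z"
  let ?p = "x \<squnion> (y \<sqinter> z)" and ?q = "(x \<squnion> y) \<sqinter> z"
  note lat = join_left join_right meet_left meet_right
  have yzx: "y \<sqinter> z \<sqsubseteq> x \<squnion> y"
    using c by (meson join_closed join_right le_trans meet_closed meet_left)
  have pq: "?p \<sqsubseteq> ?q"
    using c xz yzx by (intro join_le meet_le) (auto intro: lat)
  have "?q \<squnion> y \<sqsubseteq> ?p \<squnion> y"
  proof -
    have "x \<sqsubseteq> ?p \<squnion> y" "y \<sqsubseteq> ?p \<squnion> y"
      using c by (meson join_closed join_left join_right le_trans meet_closed)+
    moreover have "?q \<sqsubseteq> x \<squnion> y" using c by (simp add: meet_left)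
    moreover have "x \<squnion> y \<sqsubseteq> ?p \<squnion> y" using c calculation by (intro join_le) auto
    ultimately show ?thesis using c
      by (intro join_le) (auto intro: le_trans[of ?q "x \<squnion> y"])
  qed
  moreover have "?p \<squnion> y \<sqsubseteq> ?q \<squnion> y"
    using c pq by (intro join_mono) auto
  moreover have "?q \<sqinter> y \<sqsubseteq> ?p \<sqinter> y"
  proof -
    have "?q \<sqinter> y \<sqsubseteq> z" "?q \<sqinter> y \<sqsubseteq> y"
      using c by (meson join_closed meet_closed meet_left meet_right le_trans)+
    then have "?q \<sqinter> y \<sqsubseteq> y \<sqinter> z" using c by (intro meet_le) auto
    moreover have "y \<sqinter> z \<sqsubseteq> ?p" using c by (simp add: join_right)
    ultimately show ?thesis using c
      by (intro meet_le) (auto intro: le_trans[of _ "y \<sqinter> z"] lat)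
  qed
  moreover have "?p \<sqinter> y \<sqsubseteq> ?q \<sqinter> y"
    using c pq by (intro meet_mono) auto
  ultimately have "?p \<squnion> y = ?q \<squnion> y" "?p \<sqinter> y = ?q \<sqinter> y"
    using c by (auto intro: le_antisym)
  then show "?p = ?q"
    using c pq by (intro cancel[of ?p y ?q]) auto
qed

lemma (in distributive_lattice) distributive_cancel:
  assumes "x \<in> carrier L" "y \<in> carrier L" "z \<in> carrier L"
    and "x \<squnion> y = z \<squnion> y" "x \<sqinter> y = z \<sqinter> y"
  shows "x = z"
proof -
  have absorb: "a = a \<sqinter> (a \<squnion> y)" if "a \<in> carrier L" for a
    using that assms(2) by (metis join_closed join_left le_antisym le_refl meet_closed meet_le meet_left)
  have "x = (x \<sqinter> z) \<squnion> (x \<sqinter> y)"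
    using absorb[of x] assms distributive[of x z y] by simp
  also have "\<dots> = (z \<sqinter> x) \<squnion> (z \<sqinter> y)"
    using assms by (simp add: meet_comm)
  also have "\<dots> = z"
    using absorb[of z] assms distributive[of z x y] by simp
  finally show ?thesis .
qed

lemma (in modular_lattice) dual_modular_lattice: "modular_lattice (inv_gorder L)"
proof -
  interpret dual: lattice "inv_gorder L" by (rule dual_lattice)
  show ?thesis
  proof (rule modular_lattice.intro[OF dual.lattice_axioms], unfold_locales, simp)
    fix x y z assume "x \<in> carrier L" "y \<in> carrier L" "z \<in> carrier L" "z \<sqsubseteq> x"
    then show "x \<sqinter> (y \<squnion> z) = (x \<sqinter> y) \<squnion> z"
      using modular[of z y x] by (simp add: meet_comm join_comm)
  qed
qed

text \<open>
  In a modular lattice, the three elements obtained by permuting \<open>x\<close>, \<open>y\<close>, \<open>z\<close> cyclically here are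
  the atoms of a sublattice that is a diamond \<open>M\<^sub>3\<close> or collapses to a point; it collapses for all
  \<open>x\<close>, \<open>y\<close>, \<open>z\<close> exactly when the lattice is distributive.
\<close>

definition diamond_atom :: "('a, 'm) gorder_scheme \<Rightarrow> 'a \<Rightarrow> 'a \<Rightarrow> 'a \<Rightarrow> 'a" where
  "diamond_atom L x y z = (x \<sqinter>\<^bsub>L\<^esub> (y \<squnion>\<^bsub>L\<^esub> z)) \<squnion>\<^bsub>L\<^esub> (y \<sqinter>\<^bsub>L\<^esub> z)"

lemma (in modular_lattice) diamond_atom_closed [simp]:
  "\<lbrakk>x \<in> carrier L; y \<in> carrier L; z \<in> carrier L\<rbrakk> \<Longrightarrow> diamond_atom L x y z \<in> carrier L"
  by (simp add: diamond_atom_def)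

text \<open>
  This self-duality, an instance of the modular law, yields the pairwise meets of the atoms from
  their pairwise joins.
\<close>

lemma (in modular_lattice) diamond_atom_dual:
  assumes "x \<in> carrier L" "y \<in> carrier L" "z \<in> carrier L"
  shows "diamond_atom (inv_gorder L) x y z = diamond_atom L x y z"
proof -
  have "y \<sqinter> z \<sqsubseteq> y \<squnion> z"
    using assms by (meson join_closed join_left le_trans meet_closed meet_left)
  then show ?thesis
    using assms modular[of "y \<sqinter> z" x "y \<squnion> z"] by (simp add: diamond_atom_def meet_comm join_comm)
qed

text \<open>
  Two applications of the modular law evaluate the join of the two main terms \<open>x \<sqinter> (y \<squnion> z)\<close> and
  \<open>y \<sqinter> (z \<squnion> x)\<close>; each of the remaining terms is absorbed by the main term of the other atom. The
  result is invariant under cyclic permutation, so all three pairs of atoms have the same join.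
\<close>

lemma (in modular_lattice) diamond_atom_join:
  assumes c: "x \<in> carrier L" "y \<in> carrier L" "z \<in> carrier L"
  shows "diamond_atom L x y z \<squnion> diamond_atom L y z x = (x \<squnion> y) \<sqinter> (y \<squnion> z) \<sqinter> (z \<squnion> x)"
proof -
  let ?u = "x \<sqinter> (y \<squnion> z)" and ?v = "y \<sqinter> (z \<squnion> x)"
  let ?e = "(x \<squnion> y) \<sqinter> (y \<squnion> z) \<sqinter> (z \<squnion> x)"
  note lat = join_left join_right meet_left meet_right
  have uzx: "?u \<sqsubseteq> z \<squnion> x"
    using c by (meson join_closed join_right le_trans meet_closed meet_left)
  have "?u \<squnion> ?v = (?u \<squnion> y) \<sqinter> (z \<squnion> x)"
    using c modular[of ?u y "z \<squnion> x"] uzx by simp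
  moreover have "?u \<squnion> y = (x \<squnion> y) \<sqinter> (y \<squnion> z)"
    using c modular[of y x "y \<squnion> z"] by (simp add: join_left join_comm)
  ultimately have uv: "?u \<squnion> ?v = ?e" by simp
  have "y \<sqinter> z \<sqsubseteq> ?v"
    using c by (intro meet_le) (auto intro: lat le_trans[of _ z "z \<squnion> x"])
  moreover have "z \<sqinter> x \<sqsubseteq> ?u"
    using c by (intro meet_le) (auto intro: lat le_trans[of _ z "y \<squnion> z"])
  moreover have "?u \<sqsubseteq> ?u \<squnion> ?v" "?v \<sqsubseteq> ?u \<squnion> ?v" using c by (auto intro: lat)
  ultimately have "diamond_atom L x y z \<squnion> diamond_atom L y z x \<sqsubseteq> ?u \<squnion> ?v"
    unfolding diamond_atom_def using c
    by (intro join_le) (auto intro: le_trans[of _ ?v] le_trans[of _ ?u])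
  moreover have "?u \<squnion> ?v \<sqsubseteq> diamond_atom L x y z \<squnion> diamond_atom L y z x"
    unfolding diamond_atom_def using c by (intro join_mono) (auto intro: lat)
  ultimately show ?thesis
    using c uv by (metis join_closed le_antisym diamond_atom_closed meet_closed)
qed

text \<open>
  Cancellation collapses the diamond: two of its atoms have the same join and the same meet with
  the third. Hence \<open>x \<sqinter> (y \<squnion> z)\<close>, which lies below an atom, lies below the bottom \<open>d\<close> of the
  diamond, and the modular law evaluates \<open>d \<sqinter> x\<close> as \<open>(x \<sqinter> y) \<squnion> (x \<sqinter> z)\<close>.
\<close>

lemma (in modular_lattice) distributive_latticeI:
  assumes cancel: "\<And>x y z. \<lbrakk>x \<in> carrier L; y \<in> carrier L; z \<in> carrier L;
    x \<squnion> y = z \<squnion> y; x \<sqinter> y = z \<sqinter> y\<rbrakk> \<Longrightarrow> x = z"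
  shows "distributive_lattice L"
proof unfold_locales
  fix x y z assume c: "x \<in> carrier L" "y \<in> carrier L" "z \<in> carrier L"
  interpret dual: modular_lattice "inv_gorder L" by (rule dual_modular_lattice)
  note lat = join_left join_right meet_left meet_right
  let ?p = "diamond_atom L x y z" and ?q = "diamond_atom L y z x" and ?r = "diamond_atom L z x y"
  let ?e = "(x \<squnion> y) \<sqinter> (y \<squnion> z) \<sqinter> (z \<squnion> x)"
  let ?d = "(x \<sqinter> y) \<squnion> (y \<sqinter> z) \<squnion> (z \<sqinter> x)"
  have assoc: "a \<sqinter> b \<sqinter> c = b \<sqinter> c \<sqinter> a" "a \<squnion> b \<squnion> c = b \<squnion> c \<squnion> a"
    if "a \<in> carrier L" "b \<in> carrier L" "c \<in> carrier L" for a b c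
    using that weak_meet_assoc[of a b c] weak_join_assoc[of a b c]
    by (simp_all add: eq_is_equal meet_comm[of L _ a] join_comm[of L _ a])
  have joins: "?p \<squnion> ?q = ?e" "?q \<squnion> ?r = ?e" "?r \<squnion> ?p = ?e"
    using diamond_atom_join[of x y z] diamond_atom_join[of y z x] diamond_atom_join[of z x y]
      assoc(1)[of "x \<squnion> y" "y \<squnion> z" "z \<squnion> x"] assoc(1)[of "z \<squnion> x" "x \<squnion> y" "y \<squnion> z"] c
    by simp_all
  have meets: "?p \<sqinter> ?q = ?d" "?q \<sqinter> ?r = ?d" "?r \<sqinter> ?p = ?d"
    using dual.diamond_atom_join[of x y z] dual.diamond_atom_join[of y z x]
      dual.diamond_atom_join[of z x y]
      assoc(2)[of "x \<sqinter> y" "y \<sqinter> z" "z \<sqinter> x"] assoc(2)[of "z \<sqinter> x" "x \<sqinter> y" "y \<sqinter> z"] c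
    by (simp_all add: diamond_atom_dual)
  have "?p = ?r"
    using c joins meets by (intro cancel[of ?p ?q ?r]) (simp_all add: join_comm meet_comm)
  then have pd: "?p = ?d"
    using c meets(3) by (metis le_antisym meet_closed meet_le meet_left le_refl diamond_atom_closed)
  have "x \<sqinter> (y \<squnion> z) \<sqsubseteq> ?d"
    using c pd[symmetric] by (simp add: diamond_atom_def lat)
  then have 1: "x \<sqinter> (y \<squnion> z) \<sqsubseteq> ?d \<sqinter> x"
    using c by (intro meet_le) (auto intro: lat)
  let ?w = "(x \<sqinter> y) \<squnion> (x \<sqinter> z)"
  have "?d = ?w \<squnion> (y \<sqinter> z)"
    using c assoc(2)[of "z \<sqinter> x" "x \<sqinter> y" "y \<sqinter> z"] by (simp add: meet_comm join_comm)
  moreover have wx: "?w \<sqsubseteq> x" using c by (intro join_le) (auto intro: lat)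
  ultimately have 2: "?d \<sqinter> x = ?w \<squnion> ((y \<sqinter> z) \<sqinter> x)"
    using c modular[of ?w "y \<sqinter> z" x] by simp
  have "(y \<sqinter> z) \<sqinter> x \<sqsubseteq> x \<sqinter> y"
    using c meet_mono[of "y \<sqinter> z" y x x] by (simp add: lat meet_comm[of L x])
  then have "(y \<sqinter> z) \<sqinter> x \<sqsubseteq> ?w"
    using c by (intro le_trans[OF _ join_left]) auto
  then have "?d \<sqinter> x \<sqsubseteq> ?w" unfolding 2 using c by (simp add: join_le)
  with 1 have "x \<sqinter> (y \<squnion> z) \<sqsubseteq> ?w" using c by (auto intro: le_trans[of _ "?d \<sqinter> x" ?w])
  moreover have "?w \<sqsubseteq> x \<sqinter> (y \<squnion> z)"
    using c wx by (intro meet_le join_le)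
      (auto intro: lat le_trans[of _ y "y \<squnion> z"] le_trans[of _ z "y \<squnion> z"])
  ultimately show "x \<sqinter> (y \<squnion> z) = ?w" using c by (auto intro: le_antisym)
qed

section \<open>Doubling tolerances\<close>

locale modular_doubling = modular_lattice L for L (structure) +
  fixes T :: "('a \<times> 'a) set"
  assumes doubling: "doubling_tolerance L T"
begin

lemma T_closed: "(a, b) \<in> T \<Longrightarrow> a \<in> carrier L" "(a, b) \<in> T \<Longrightarrow> b \<in> carrier L"
  and T_refl: "a \<in> carrier L \<Longrightarrow> (a, a) \<in> T"
  and T_sym: "(a, b) \<in> T \<Longrightarrow> (b, a) \<in> T"
  and T_join: "\<lbrakk>(a, b) \<in> T; (c, d) \<in> T\<rbrakk> \<Longrightarrow> (a \<squnion> c, b \<squnion> d) \<in> T"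
  and T_meet: "\<lbrakk>(a, b) \<in> T; (c, d) \<in> T\<rbrakk> \<Longrightarrow> (a \<sqinter> c, b \<sqinter> d) \<in> T"
  using doubling unfolding doubling_tolerance_def tolerance_def refl_on_def sym_def by blast+

text \<open>
  For \<open>x\<close> and \<open>y\<close> in the interval, joining \<open>(u, v)\<close> with \<open>(x, x)\<close> and \<open>(y, y)\<close> shows that both are
  related to \<open>v\<close>; the meet of \<open>(x, v)\<close> and \<open>(v, y)\<close> is then \<open>(x, y)\<close>.
\<close>

lemma interval_clique:
  assumes "(u, v) \<in> T" "u \<sqsubseteq> v"
  shows "\<lbrace>u..v\<rbrace> \<times> \<lbrace>u..v\<rbrace> \<subseteq> T"
proof clarify
  fix x y assume "x \<in> \<lbrace>u..v\<rbrace>" "y \<in> \<lbrace>u..v\<rbrace>"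
  then have c: "x \<in> carrier L" "y \<in> carrier L" and le: "u \<sqsubseteq> x" "x \<sqsubseteq> v" "u \<sqsubseteq> y" "y \<sqsubseteq> v"
    by (auto simp: at_least_at_most_def)
  note uv = T_closed[OF assms(1)]
  have "(x, v) \<in> T"
    using T_join[OF assms(1) T_refl[OF c(1)]] le c uv by (simp add: join_absorb join_comm[of L v])
  moreover have "(y, v) \<in> T"
    using T_join[OF assms(1) T_refl[OF c(2)]] le c uv by (simp add: join_absorb join_comm[of L v])
  ultimately have "(x \<sqinter> v, v \<sqinter> y) \<in> T" by (blast intro: T_meet dest: T_sym)
  then show "(x, y) \<in> T" using le c uv by (simp add: meet_absorb meet_comm[of L v])
qed

text \<open>
  Zorn's lemma extends a clique of \<open>T\<close> to a block, so the bound on the size of blocks bounds all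
  cliques.
\<close>

lemma clique_small:
  assumes "X \<subseteq> carrier L" "X \<times> X \<subseteq> T"
  shows "\<exists>B \<in> blocks L T. X \<subseteq> B \<and> finite B \<and> card B \<le> 2"
proof -
  define \<A> where "\<A> = {Y. Y \<subseteq> carrier L \<and> Y \<times> Y \<subseteq> T \<and> X \<subseteq> Y}"
  have "\<exists>M\<in>\<A>. \<forall>Y\<in>\<A>. M \<subseteq> Y \<longrightarrow> Y = M"
  proof (rule subset_Zorn_nonempty)
    show "\<A> \<noteq> {}" using assms by (auto simp: \<A>_def)
    fix \<C> assume C: "\<C> \<noteq> {}" "subset.chain \<A> \<C>"
    then have sub: "\<C> \<subseteq> \<A>" and lin: "\<And>A B. \<lbrakk>A \<in> \<C>; B \<in> \<C>\<rbrakk> \<Longrightarrow> A \<subseteq> B \<or> B \<subseteq> A"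
      by (auto simp: subset_chain_def)
    have mem: "A \<subseteq> carrier L" "A \<times> A \<subseteq> T" "X \<subseteq> A" if "A \<in> \<C>" for A
      using that sub unfolding \<A>_def by auto
    have "\<Union>\<C> \<times> \<Union>\<C> \<subseteq> T"
    proof clarify
      fix a b A B assume *: "a \<in> A" "A \<in> \<C>" "b \<in> B" "B \<in> \<C>"
      show "(a, b) \<in> T"
        using lin[OF *(2,4)] mem(2)[OF *(2)] mem(2)[OF *(4)] *(1,3) by auto
    qed
    moreover have "\<Union>\<C> \<subseteq> carrier L" using mem(1) by (rule Union_least)
    moreover have "X \<subseteq> \<Union>\<C>" using C(1) mem(3) by fastforce
    ultimately show "\<Union>\<C> \<in> \<A>" unfolding \<A>_def by simp
  qed
  then obtain M where M: "M \<in> \<A>" "\<forall>Y\<in>\<A>. M \<subseteq> Y \<longrightarrow> Y = M" ..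
  have "Y = M" if "Y \<subseteq> carrier L" "Y \<times> Y \<subseteq> T" "M \<subseteq> Y" for Y
  proof -
    have "Y \<in> \<A>" using that M(1) unfolding \<A>_def by fastforce
    then show ?thesis using M(2) that(3) by simp
  qed
  then have "M \<in> blocks L T" using M(1) unfolding blocks_def \<A>_def by simp
  moreover have "X \<subseteq> M" using M(1) by (simp add: \<A>_def)
  ultimately show ?thesis using doubling unfolding doubling_tolerance_def by blast
qed

lemma interval_two:
  assumes "(u, v) \<in> T" "u \<sqsubseteq> x" "x \<sqsubseteq> v" "x \<in> carrier L"
  shows "x = u \<or> x = v"
proof (rule ccontr)
  assume neq: "\<not> ?thesis"
  note uv = T_closed[OF assms(1)]
  have le: "u \<sqsubseteq> v" using le_trans[OF assms(2,3)] uv assms(4) by simp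
  then have "u \<noteq> v" using neq assms uv le_antisym[of x u] by auto
  obtain B where B: "\<lbrace>u..v\<rbrace> \<subseteq> B" "finite B" "card B \<le> 2"
    using clique_small[OF _ interval_clique[OF assms(1) le]] at_least_at_most_closed by blast
  have "{u, x, v} \<subseteq> \<lbrace>u..v\<rbrace>"
    using assms uv le by (auto simp: at_least_at_most_def)
  then have "card {u, x, v} \<le> 2" using B by (meson card_mono order_trans)
  then show False using neq \<open>u \<noteq> v\<close> by auto
qed

text \<open>
  This form of the covering relation mentions only the order and \<open>T\<close>; the converse direction
  holds because an interval between related elements is a clique of at most two elements, hence
  already a block if it has two.
\<close>

lemma block_cover_iff:
  "block_cover L T a b \<longleftrightarrow> (a, b) \<in> T \<and> a \<sqsubseteq> b \<and> a \<noteq> b"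
proof
  assume bc: "block_cover L T a b"
  then have c: "a \<in> carrier L" "b \<in> carrier L" and bl: "\<lbrace>a..b\<rbrace> \<in> blocks L T"
    and card: "card \<lbrace>a..b\<rbrace> = 2" by (auto simp: block_cover_def)
  from card have "\<lbrace>a..b\<rbrace> \<noteq> {}" by auto
  then have ab: "a \<sqsubseteq> b" using c le_trans[of a _ b] by (auto simp: at_least_at_most_def)
  moreover have "a \<noteq> b"
  proof
    assume "a = b"
    then have "\<lbrace>a..b\<rbrace> \<subseteq> {a}" using c by (auto simp: at_least_at_most_def)
    then have "card \<lbrace>a..b\<rbrace> \<le> 1" using card_mono[of "{a}"] by simp
    then show False using card by simp
  qed
  moreover have "(a, b) \<in> \<lbrace>a..b\<rbrace> \<times> \<lbrace>a..b\<rbrace>" using c ab by (auto simp: at_least_at_most_def)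
  then have "(a, b) \<in> T" using bl unfolding blocks_def by blast
  ultimately show "(a, b) \<in> T \<and> a \<sqsubseteq> b \<and> a \<noteq> b" by blast
next
  assume *: "(a, b) \<in> T \<and> a \<sqsubseteq> b \<and> a \<noteq> b"
  then have c: "a \<in> carrier L" "b \<in> carrier L" using T_closed by auto
  have int: "\<lbrace>a..b\<rbrace> = {a, b}"
    using * c interval_two[of a b] by (auto simp: at_least_at_most_def)
  obtain B where B: "B \<in> blocks L T" "\<lbrace>a..b\<rbrace> \<subseteq> B" "finite B" "card B \<le> 2"
    using clique_small[OF _ interval_clique[of a b]] at_least_at_most_closed * by blast
  have "\<lbrace>a..b\<rbrace> = B"
    using B * int by (intro card_seteq) auto
  then show "block_cover L T a b" using B(1) * int c by (auto simp: block_cover_def)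
qed

text \<open>
  Only \<open>c \<squnion> c' \<noteq> d \<squnion> d'\<close> is at stake. If these joins were equal, then \<open>d \<squnion> c' = c \<squnion> c'\<close>, and modular
  cancellation gives \<open>d \<sqinter> c' \<noteq> c \<sqinter> c'\<close>; likewise \<open>c \<sqinter> d' \<noteq> c \<sqinter> c'\<close>. The interval from \<open>c \<sqinter> c'\<close> to
  \<open>d \<sqinter> d'\<close> has at most two elements, so \<open>d \<sqinter> c'\<close> and \<open>c \<sqinter> d'\<close> coincide with its top; but an
  element below both \<open>c\<close> and \<open>c'\<close> lies below \<open>c \<sqinter> c'\<close>.
\<close>

lemma block_cover_join:
  assumes "block_cover L T c d" "block_cover L T c' d'"
  shows "block_cover L T (c \<squnion> c') (d \<squnion> d')"
proof -
  note * = assms[unfolded block_cover_iff]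
  have cl: "c \<in> carrier L" "d \<in> carrier L" "c' \<in> carrier L" "d' \<in> carrier L"
    using * T_closed by auto
  have le: "c \<squnion> c' \<sqsubseteq> d \<squnion> d'"
    using * cl by (auto intro!: join_mono)
  have "c \<squnion> c' \<noteq> d \<squnion> d'"
  proof
    assume eq: "c \<squnion> c' = d \<squnion> d'"
    have T: "(c \<sqinter> c', d \<sqinter> d') \<in> T" using * T_meet by blast
    have below: "c \<sqinter> c' \<sqsubseteq> d \<sqinter> c'" "c \<sqinter> c' \<sqsubseteq> c \<sqinter> d'" "d \<sqinter> c' \<sqsubseteq> d \<sqinter> d'" "c \<sqinter> d' \<sqsubseteq> d \<sqinter> d'"
      using * cl by (auto intro!: meet_mono)
    have "d \<sqinter> c' \<noteq> c \<sqinter> c'"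
    proof
      assume meq: "d \<sqinter> c' = c \<sqinter> c'"
      have "d \<squnion> c' \<sqsubseteq> c \<squnion> c'" unfolding eq
        using * cl by (auto intro!: join_mono)
      moreover have "c \<squnion> c' \<sqsubseteq> d \<squnion> c'"
        using * cl by (auto intro!: join_mono)
      ultimately have "c \<squnion> c' = d \<squnion> c'" using cl by (auto intro: le_antisym)
      then show False using modular_cancel[of c c' d] meq * cl by simp
    qed
    moreover have "c \<sqinter> d' \<noteq> c \<sqinter> c'"
    proof
      assume meq: "c \<sqinter> d' = c \<sqinter> c'"
      have "d' \<squnion> c \<sqsubseteq> c \<squnion> c'" unfolding eq
        using * cl join_mono[of d' d' c d] by (metis join_comm le_refl)
      moreover have "c' \<squnion> c \<sqsubseteq> d' \<squnion> c"
        using * cl by (auto intro!: join_mono)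
      ultimately have "c' \<squnion> c = d' \<squnion> c" using cl by (auto intro: le_antisym simp: join_comm[of L c'])
      then show False using modular_cancel[of c' c d'] meq * cl by (simp add: meet_comm)
    qed
    ultimately have "d \<sqinter> c' = c \<sqinter> d'"
      using interval_two[OF T, of "d \<sqinter> c'"] interval_two[OF T, of "c \<sqinter> d'"] below cl by auto
    then have "d \<sqinter> c' \<sqsubseteq> c \<sqinter> c'" using cl by (metis meet_closed meet_le meet_left meet_right)
    with \<open>d \<sqinter> c' \<noteq> c \<sqinter> c'\<close> below(1) cl show False by (auto intro: le_antisym)
  qed
  then show ?thesis using le * T_join by (auto simp: block_cover_iff)
qed

end

lemma (in modular_doubling) dual_modular_doubling: "modular_doubling (inv_gorder L) T"
proof -
  interpret dual: modular_lattice "inv_gorder L" by (rule dual_modular_lattice)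
  have "blocks (inv_gorder L) T = blocks L T" by (simp add: blocks_def)
  then show ?thesis
    using doubling by unfold_locales (auto simp: doubling_tolerance_def tolerance_def)
qed

text \<open>
  This is the condition for \<open>(a, 1)\<close> to lie below \<open>(b, 0)\<close>: along a chain of steps of \<open>\<pi>\<close> and \<open>\<tau>\<close>
  the first component never decreases, and only a step of \<open>\<tau>\<close> leads from layer 1 to layer 0.
\<close>

definition ascends :: "('a, 'm) gorder_scheme \<Rightarrow> ('a \<times> 'a) set \<Rightarrow> 'a \<Rightarrow> 'a \<Rightarrow> bool" where
  "ascends L T a b \<longleftrightarrow> (\<exists>c d. a \<sqsubseteq>\<^bsub>L\<^esub> c \<and> block_cover L T c d \<and> d \<sqsubseteq>\<^bsub>L\<^esub> b)"

context modular_doubling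
begin

lemma ascends_dual [simp]: "ascends (inv_gorder L) T a b \<longleftrightarrow> ascends L T b a"
proof -
  interpret dual: modular_doubling "inv_gorder L" T by (rule dual_modular_doubling)
  have "block_cover (inv_gorder L) T c d \<longleftrightarrow> block_cover L T d c" for c d
    unfolding block_cover_iff dual.block_cover_iff using T_sym by auto
  then show ?thesis by (auto simp: ascends_def)
qed

lemma ascendsI:
  "\<lbrakk>(c, d) \<in> T; c \<sqsubseteq> d; c \<noteq> d; a \<sqsubseteq> c; d \<sqsubseteq> b\<rbrakk> \<Longrightarrow> ascends L T a b"
  by (auto simp: ascends_def block_cover_iff)

lemma ascendsE:
  assumes "ascends L T a b"
  obtains c d where "(c, d) \<in> T" "c \<in> carrier L" "d \<in> carrier L" "c \<sqsubseteq> d" "c \<noteq> d" "a \<sqsubseteq> c" "d \<sqsubseteq> b"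
  using assms T_closed by (auto simp: ascends_def block_cover_iff)

lemma ascends_mono:
  assumes "ascends L T a b" "a' \<sqsubseteq> a" "b \<sqsubseteq> b'"
    "a \<in> carrier L" "b \<in> carrier L" "a' \<in> carrier L" "b' \<in> carrier L"
  shows "ascends L T a' b'"
  proof -
  obtain c d where *: "(c, d) \<in> T" "c \<in> carrier L" "d \<in> carrier L" "c \<sqsubseteq> d" "c \<noteq> d" "a \<sqsubseteq> c" "d \<sqsubseteq> b"
    using assms(1) by (rule ascendsE)
  then have "a' \<sqsubseteq> c" "d \<sqsubseteq> b'"
    using assms le_trans[of a' a c] le_trans[of d b b'] by auto
  then show ?thesis using * ascendsI by blast
qed

lemma ascends_less:
  assumes "ascends L T a b" "a \<in> carrier L" "b \<in> carrier L"
  shows "a \<sqsubseteq> b" "a \<noteq> b"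
proof -
  obtain c d where *: "c \<in> carrier L" "d \<in> carrier L" "c \<sqsubseteq> d" "c \<noteq> d" "a \<sqsubseteq> c" "d \<sqsubseteq> b"
    using assms(1) by (rule ascendsE)
  then have "a \<sqsubseteq> d" using assms le_trans[of a c d] by blast
  then show "a \<sqsubseteq> b" using * assms le_trans[of a d b] by blast
  show "a \<noteq> b"
  proof
    assume "a = b"
    then have "d \<sqsubseteq> c" using * assms le_trans[of d a c] by blast
    then show False using * by (auto intro: le_antisym)
  qed
qed

lemma ascends_join:
  assumes "ascends L T a x" "ascends L T b x" "a \<in> carrier L" "b \<in> carrier L" "x \<in> carrier L"
  shows "ascends L T (a \<squnion> b) x"
proof -
  obtain c d where 1: "a \<sqsubseteq> c" "block_cover L T c d" "d \<sqsubseteq> x"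
    using assms by (auto simp: ascends_def)
  obtain c' d' where 2: "b \<sqsubseteq> c'" "block_cover L T c' d'" "d' \<sqsubseteq> x"
    using assms by (auto simp: ascends_def)
  have cl: "c \<in> carrier L" "d \<in> carrier L" "c' \<in> carrier L" "d' \<in> carrier L"
    using 1 2 by (auto simp: block_cover_def)
  have "a \<squnion> b \<sqsubseteq> c \<squnion> c'"
    using 1 2 cl assms by (auto intro!: join_mono)
  moreover have "d \<squnion> d' \<sqsubseteq> x" using 1 2 cl assms by (intro join_le) auto
  ultimately show ?thesis using block_cover_join[OF 1(2) 2(2)] by (auto simp: ascends_def)
qed

text \<open>
  A pair \<open>c \<prec>\<^sub>T d\<close> between \<open>b\<close> and \<open>x\<close> can be moved above or below \<open>u = a \<squnion> b\<close>: joining it with \<open>u\<close>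
  puts it between \<open>u\<close> and \<open>x\<close>, meeting it with \<open>u\<close> puts it between \<open>b\<close> and \<open>u\<close>. By modular
  cancellation the pair cannot collapse under both operations.
\<close>

lemma ascends_split:
  assumes "ascends L T b x" "a \<sqsubseteq> x" "a \<in> carrier L" "b \<in> carrier L" "x \<in> carrier L"
  shows "ascends L T (a \<squnion> b) x \<or> ascends L T b (a \<squnion> b)"
proof -
  obtain c d where *: "(c, d) \<in> T" "c \<in> carrier L" "d \<in> carrier L" "c \<sqsubseteq> d" "c \<noteq> d" "b \<sqsubseteq> c" "d \<sqsubseteq> x"
    using assms(1) by (rule ascendsE)
  let ?u = "a \<squnion> b"
  have cl: "?u \<in> carrier L" using assms by simp
  have bu: "b \<sqsubseteq> ?u" using assms by (simp add: join_right)
  have ux: "?u \<sqsubseteq> x" using assms * le_trans[of b c x] le_trans[of c d x] le_trans[of b c d]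
      ascends_less(1)[OF assms(1)] by (intro join_le) auto
  have "c \<squnion> ?u \<noteq> d \<squnion> ?u \<or> c \<sqinter> ?u \<noteq> d \<sqinter> ?u"
    using modular_cancel[of c ?u d] * cl by blast
  then show ?thesis
  proof
    assume neq: "c \<squnion> ?u \<noteq> d \<squnion> ?u"
    have "(c \<squnion> ?u, d \<squnion> ?u) \<in> T" using T_join * T_refl cl by blast
    moreover have "c \<squnion> ?u \<sqsubseteq> d \<squnion> ?u" 
      using * cl assms by (intro join_mono) auto
    moreover have "?u \<sqsubseteq> c \<squnion> ?u" "d \<squnion> ?u \<sqsubseteq> x"
      using * cl ux assms by (auto intro: join_le join_right)
    ultimately show ?thesis using ascendsI neq by blast
  next
    assume neq: "c \<sqinter> ?u \<noteq> d \<sqinter> ?u"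
    have "(c \<sqinter> ?u, d \<sqinter> ?u) \<in> T" using T_meet * T_refl cl by blast
    moreover have "c \<sqinter> ?u \<sqsubseteq> d \<sqinter> ?u" 
      using * cl by (intro meet_mono) auto
    moreover have "b \<sqsubseteq> c \<sqinter> ?u" "d \<sqinter> ?u \<sqsubseteq> ?u"
      using * cl bu assms by (auto intro: meet_le meet_right)
    ultimately show ?thesis using ascendsI neq by blast
  qed
qed

text \<open>
  A pair \<open>c \<prec>\<^sub>T d\<close> between \<open>x \<sqinter> y\<close> and \<open>x\<close> collapses when it is met with \<open>y\<close>, so by modular
  cancellation its join with \<open>y\<close> remains a pair of distinct elements.
\<close>

lemma ascends_transpose_up:
  assumes "ascends L T (x \<sqinter> y) x" "x \<in> carrier L" "y \<in> carrier L"
  shows "ascends L T y (x \<squnion> y)"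
proof -
  obtain c d where *: "(c, d) \<in> T" "c \<in> carrier L" "d \<in> carrier L" "c \<sqsubseteq> d" "c \<noteq> d"
    "x \<sqinter> y \<sqsubseteq> c" "d \<sqsubseteq> x"
    using assms(1) by (rule ascendsE)
  have "d \<sqinter> y \<sqsubseteq> x \<sqinter> y" using * assms by (auto intro!: meet_mono)
  then have "d \<sqinter> y \<sqsubseteq> c" using * assms by (auto intro: le_trans[of _ "x \<sqinter> y"])
  then have "d \<sqinter> y \<sqsubseteq> c \<sqinter> y" using * assms by (auto intro!: meet_le meet_right)
  moreover have "c \<sqinter> y \<sqsubseteq> d \<sqinter> y" using * assms by (auto intro!: meet_mono)
  ultimately have "c \<sqinter> y = d \<sqinter> y" using * assms by (auto intro: le_antisym)
  then have "c \<squnion> y \<noteq> d \<squnion> y" using modular_cancel[of c y d] * assms by blast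
  moreover have "(c \<squnion> y, d \<squnion> y) \<in> T" using T_join * T_refl assms by blast
  moreover have "c \<squnion> y \<sqsubseteq> d \<squnion> y" "d \<squnion> y \<sqsubseteq> x \<squnion> y" 
    using * assms by (auto intro!: join_mono)
  moreover have "y \<sqsubseteq> c \<squnion> y" using * assms by (auto intro: join_right)
  ultimately show ?thesis using ascendsI by blast
qed

text \<open>
  Otherwise \<open>x \<squnion> y\<close> would ascend to itself by \<open>ascends_join\<close>.
\<close>

lemma not_ascends_both:
  assumes "x \<in> carrier L" "y \<in> carrier L"
  shows "\<not> (ascends L T x (x \<squnion> y) \<and> ascends L T y (x \<squnion> y))"
  using ascends_join[of x "x \<squnion> y" y] ascends_less(2)[of "x \<squnion> y" "x \<squnion> y"] assms by auto

section \<open>The order of the doubled lattice\<close>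

definition doubled_le :: "'a \<times> nat \<Rightarrow> 'a \<times> nat \<Rightarrow> bool" where
  "doubled_le p q \<longleftrightarrow> fst p \<in> carrier L \<and> fst q \<in> carrier L \<and> snd p \<in> {0, 1} \<and> snd q \<in> {0, 1} \<and>
     fst p \<sqsubseteq> fst q \<and> (snd p = 1 \<and> snd q = 0 \<longrightarrow> ascends L T (fst p) (fst q))"

lemma doubled_le_trans: "\<lbrakk>doubled_le p q; doubled_le q r\<rbrakk> \<Longrightarrow> doubled_le p r"
  unfolding doubled_le_def
  using ascends_mono[of "fst p" "fst q" "fst p" "fst r"] ascends_mono[of "fst q" "fst r" "fst p" "fst r"]
  by (auto intro: le_trans[of "fst p" "fst q" "fst r"])

lemma rho_rel_iff: "(p, q) \<in> rho_rel L T \<longleftrightarrow> doubled_le p q"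
proof
  have cover: "ascends L T a b" if "(a, b) \<in> T" "a \<sqsubseteq> b" "a \<noteq> b" for a b
    using ascendsI[OF that le_refl le_refl] T_closed[OF that(1)] by simp
  have step: "doubled_le p q" if "(p, q) \<in> pi_rel L \<union> tau_rel L T" for p q
    using that cover
    by (auto simp: pi_rel_def tau_rel_def doubled_le_def block_cover_iff dest: T_closed)
  assume "(p, q) \<in> rho_rel L T"
  then show "doubled_le p q"
    unfolding rho_rel_def by (induction rule: trancl_induct) (blast intro: step doubled_le_trans)+
next
  assume d: "doubled_le p q"
  obtain a i b j where pq: "p = (a, i)" "q = (b, j)" by fastforce
  show "(p, q) \<in> rho_rel L T"
  proof (cases "i = 1 \<and> j = 0")
    case False
    then have "(p, q) \<in> pi_rel L" using d by (auto simp: pq doubled_le_def pi_rel_def)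
    then show ?thesis unfolding rho_rel_def by auto
  next
    case True
    then obtain c e where *: "a \<sqsubseteq> c" "block_cover L T c e" "e \<sqsubseteq> b"
      using d by (auto simp: pq doubled_le_def ascends_def)
    have "((a, 1), (c, 1)) \<in> pi_rel L \<union> tau_rel L T"
      "((c, 1), (e, 0)) \<in> pi_rel L \<union> tau_rel L T"
      "((e, 0), (b, 0)) \<in> pi_rel L \<union> tau_rel L T"
      using * d by (auto simp: pq doubled_le_def pi_rel_def tau_rel_def block_cover_def)
    then have "((a, 1), (b, 0)) \<in> rho_rel L T"
      unfolding rho_rel_def by (meson r_into_trancl trancl_into_trancl)
    then show ?thesis using True by (simp add: pq)
  qed
qed

lemma doubled_simps [simp]:
  "carrier (doubled L T) = carrier L \<times> {0, 1}"
  "p \<sqsubseteq>\<^bsub>doubled L T\<^esub> q \<longleftrightarrow> doubled_le p q"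
  "p .=\<^bsub>doubled L T\<^esub> q \<longleftrightarrow> p = q"
  by (auto simp: doubled_def rho_rel_iff)

lemma doubled_le_antisym: "\<lbrakk>doubled_le p q; doubled_le q p\<rbrakk> \<Longrightarrow> p = q"
  unfolding doubled_le_def
  by (cases p; cases q) (auto dest: ascends_less(2) le_antisym)

lemma partial_order_doubled: "partial_order (doubled L T)"
  by unfold_locales (auto simp: fun_eq_iff doubled_le_antisym intro: doubled_le_trans, auto simp: doubled_le_def)

text \<open>
  Let \<open>(x, 0)\<close> be an upper bound of two elements over \<open>a\<close> and \<open>b\<close> although \<open>(a \<squnion> b, 0)\<close> is not one.
  Then \<open>a \<squnion> b\<close> ascends to \<open>x\<close>, that is, \<open>(a \<squnion> b, 1)\<close> lies below \<open>(x, 0)\<close>: this is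
  \<open>ascends_join\<close> if both elements are in layer 1, and \<open>ascends_split\<close> if only one of them is.
\<close>

lemma upper_semilattice_doubled: "upper_semilattice (doubled L T)"
proof -
  interpret D: partial_order "doubled L T" by (rule partial_order_doubled)
  show ?thesis
  proof unfold_locales
    fix p q assume pq: "p \<in> carrier (doubled L T)" "q \<in> carrier (doubled L T)"
    obtain a i b j where p: "p = (a, i)" and q: "q = (b, j)" by fastforce
    have c: "a \<in> carrier L" "b \<in> carrier L" "i \<in> {0, 1}" "j \<in> {0, 1}" using pq p q by auto
    let ?u = "a \<squnion> b"
    define s where "s = (?u, if doubled_le p (?u, 0) \<and> doubled_le q (?u, 0) then 0 else 1 :: nat)"
    have u: "?u \<in> carrier L" "a \<sqsubseteq> ?u" "b \<sqsubseteq> ?u" using c by (auto intro: join_left join_right)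
    have above: "doubled_le p s" "doubled_le q s" using c u by (auto simp: s_def p q doubled_le_def)
    have least: "doubled_le s r" if r: "doubled_le p r" "doubled_le q r" for r
    proof -
      obtain x k where rx: "r = (x, k)" by fastforce
      have x: "x \<in> carrier L" "k \<in> {0, 1}" "a \<sqsubseteq> x" "b \<sqsubseteq> x"
        using r by (auto simp: rx p q doubled_le_def)
      then have ux: "?u \<sqsubseteq> x" using c by (auto intro: join_le)
      show ?thesis
      proof (cases "snd s = 1 \<and> k = 0")
        case False
        then show ?thesis using u x ux by (auto simp: s_def rx doubled_le_def)
      next
        case True
        then have nub: "\<not> (doubled_le p (?u, 0) \<and> doubled_le q (?u, 0))" by (auto simp: s_def split: if_splits)
        have ia: "ascends L T a x" if "i = 1" using r True that by (auto simp: p rx doubled_le_def)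
        have jb: "ascends L T b x" if "j = 1" using r True that by (auto simp: q rx doubled_le_def)
        have "ascends L T ?u x"
        proof (cases "i = 1"; cases "j = 1")
          assume "i = 1" "j = 1"
          then show ?thesis using ia jb ascends_join c x by blast
        next
          assume "i = 1" "j \<noteq> 1"
          then show ?thesis using nub ia ascends_split[of a x b] c u x
            by (auto simp: p q doubled_le_def join_comm)
        next
          assume "i \<noteq> 1" "j = 1"
          then show ?thesis using nub jb ascends_split[of b x a] c u x
            by (auto simp: p q doubled_le_def)
        next
          assume "i \<noteq> 1" "j \<noteq> 1"
          then show ?thesis using nub c u by (auto simp: p q doubled_le_def)
        qed
        then show ?thesis using u x ux by (auto simp: s_def rx doubled_le_def)
      qed
    qed
    have "is_lub (doubled L T) s {p, q}"
    proof (rule least_UpperI)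
      show "x \<sqsubseteq>\<^bsub>doubled L T\<^esub> s" if "x \<in> {p, q}" for x using that above by auto
      show "s \<sqsubseteq>\<^bsub>doubled L T\<^esub> r" if "r \<in> Upper (doubled L T) {p, q}" for r
        using least[of r] Upper_memD[OF that, of p] Upper_memD[OF that, of q] pq by simp
      show "{p, q} \<subseteq> carrier (doubled L T)" using pq by simp
      show "s \<in> carrier (doubled L T)" using u(1) by (simp add: s_def)
    qed
    then show "\<exists>s. is_lub (doubled L T) s {p, q}" ..
  qed
qed

end

text \<open>
  On \<open>L \<times> {0, 1}\<close> this is an isomorphism between the doubling of the dual lattice and the dual of
  the doubled lattice.
\<close>

definition flip :: "'a \<times> nat \<Rightarrow> 'a \<times> nat" where
  "flip p = (fst p, 1 - snd p)"

context modular_doubling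
begin

lemma lattice_doubled: "lattice (doubled L T)"
proof -
  interpret D: upper_semilattice "doubled L T" by (rule upper_semilattice_doubled)
  interpret dual: modular_doubling "inv_gorder L" T by (rule dual_modular_doubling)
  interpret E: upper_semilattice "doubled (inv_gorder L) T" by (rule dual.upper_semilattice_doubled)
  have flip_mem: "flip p \<in> carrier L \<times> {0, 1}" if "p \<in> carrier L \<times> {0, 1}" for p
    using that by (auto simp: flip_def)
  have flip_le: "dual.doubled_le (flip p) s \<longleftrightarrow> doubled_le (flip s) p" "dual.doubled_le s (flip p) \<longleftrightarrow> doubled_le p (flip s)"
    if "p \<in> carrier L \<times> {0, 1}" "s \<in> carrier L \<times> {0, 1}" for p s
    using that by (auto simp: flip_def doubled_le_def dual.doubled_le_def)
  show ?thesis
  proof unfold_locales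
    fix p q assume pq: "p \<in> carrier (doubled L T)" "q \<in> carrier (doubled L T)"
    then have "flip p \<in> carrier (doubled (inv_gorder L) T)" "flip q \<in> carrier (doubled (inv_gorder L) T)"
      using flip_mem[of p] flip_mem[of q] by simp_all
    then obtain s where s: "is_lub (doubled (inv_gorder L) T) s {flip p, flip q}"
      using E.sup_of_two_exists by blast
    have sc: "s \<in> carrier L \<times> {0, 1}" using least_closed[OF s] by simp
    have "is_glb (doubled L T) (flip s) {p, q}"
    proof (rule greatest_LowerI)
      fix x assume "x \<in> {p, q}"
      then have "dual.doubled_le (flip x) s" "x \<in> carrier L \<times> {0, 1}"
        using least_Upper_above[OF s, of "flip x"] pq flip_mem by auto
      then show "flip s \<sqsubseteq>\<^bsub>doubled L T\<^esub> x" using flip_le(1) sc by simp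
    next
      fix y assume y: "y \<in> Lower (doubled L T) {p, q}"
      then have yc: "y \<in> carrier L \<times> {0, 1}" and "doubled_le y p" "doubled_le y q"
        using pq by (auto simp: Lower_def)
      moreover have "flip (flip y) = y" using yc by (auto simp: flip_def)
      ultimately have "dual.doubled_le (flip p) (flip y)" "dual.doubled_le (flip q) (flip y)"
        using flip_le(1)[of _ "flip y"] flip_mem[OF yc] pq by simp_all
      then have "flip y \<in> Upper (doubled (inv_gorder L) T) {flip p, flip q}"
        using flip_mem[OF yc] by (auto simp: Upper_def)
      then have "dual.doubled_le s (flip y)" using least_le[OF s] by simp
      then show "y \<sqsubseteq>\<^bsub>doubled L T\<^esub> flip s" using flip_le(2) sc yc by simp
    qed (use pq flip_mem[OF sc] in simp_all)
    then show "\<exists>s. is_glb (doubled L T) s {p, q}" ..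
  qed
qed

section \<open>Cancellation and chains in the doubled lattice\<close>

text \<open>
  \<open>(a \<squnion> b, 1)\<close> is an upper bound of any two elements over \<open>a\<close> and \<open>b\<close>, and \<open>(a \<sqinter> b, 0)\<close> is a lower
  bound.
\<close>

lemma fst_doubled:
  assumes "p \<in> carrier L \<times> {0, 1}" "q \<in> carrier L \<times> {0, 1}"
  shows "fst (p \<squnion>\<^bsub>doubled L T\<^esub> q) = fst p \<squnion> fst q"
    and "fst (p \<sqinter>\<^bsub>doubled L T\<^esub> q) = fst p \<sqinter> fst q"
proof -
  interpret D: lattice "doubled L T" by (rule lattice_doubled)
  let ?j = "p \<squnion>\<^bsub>doubled L T\<^esub> q" and ?m = "p \<sqinter>\<^bsub>doubled L T\<^esub> q"
  have c: "fst p \<in> carrier L" "fst q \<in> carrier L" using assms by auto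
  have jm: "fst ?j \<in> carrier L" "fst ?m \<in> carrier L"
    using D.join_closed[of p q] D.meet_closed[of p q] assms by (simp_all add: mem_Times_iff)
  have "doubled_le ?j (fst p \<squnion> fst q, 1)"
    using D.join_le[of p "(fst p \<squnion> fst q, 1)" q] assms c
    by (simp add: doubled_le_def join_left join_right mem_Times_iff)
  then have "fst ?j \<sqsubseteq> fst p \<squnion> fst q" by (simp add: doubled_le_def)
  moreover have "fst p \<squnion> fst q \<sqsubseteq> fst ?j"
    using D.join_left[of p q] D.join_right[of p q] assms c jm
    by (intro join_le) (simp_all add: doubled_le_def)
  ultimately show "fst ?j = fst p \<squnion> fst q" using c jm by (simp add: le_antisym)
  have "doubled_le (fst p \<sqinter> fst q, 0) ?m"
    using D.meet_le[of "(fst p \<sqinter> fst q, 0)" p q] assms c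
    by (simp add: doubled_le_def meet_left meet_right mem_Times_iff)
  then have "fst p \<sqinter> fst q \<sqsubseteq> fst ?m" by (simp add: doubled_le_def)
  moreover have "fst ?m \<sqsubseteq> fst p \<sqinter> fst q"
    using D.meet_left[of p q] D.meet_right[of p q] assms c jm
    by (intro meet_le) (simp_all add: doubled_le_def)
  ultimately show "fst ?m = fst p \<sqinter> fst q" using c jm by (simp add: le_antisym)
qed

text \<open>
  Equal joins say that an upper bound of \<open>(x, 0)\<close> and \<open>q\<close> lies above \<open>(x, 1)\<close>; equal meets say
  that a lower bound of \<open>(x, 1)\<close> and \<open>q\<close> lies below \<open>(x, 0)\<close>. If \<open>q = (y, 1)\<close>, the lower bound
  \<open>(x \<sqinter> y, 1)\<close> shows that \<open>x \<sqinter> y\<close> ascends to \<open>x\<close>, hence \<open>y\<close> ascends to \<open>x \<squnion> y\<close>. This makes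
  \<open>(x \<squnion> y, 0)\<close> an upper bound, so that \<open>x\<close> ascends to \<open>x \<squnion> y\<close> as well, which is impossible. The
  case \<open>q = (y, 0)\<close> is dual.
\<close>

lemma fibre_cancel:
  assumes x: "x \<in> carrier L" and q: "q \<in> carrier L \<times> {0, 1}"
    and j: "(x, 0) \<squnion>\<^bsub>doubled L T\<^esub> q = (x, 1) \<squnion>\<^bsub>doubled L T\<^esub> q"
    and m: "(x, 0) \<sqinter>\<^bsub>doubled L T\<^esub> q = (x, 1) \<sqinter>\<^bsub>doubled L T\<^esub> q"
  shows False
proof -
  interpret D: lattice "doubled L T" by (rule lattice_doubled)
  interpret dual: modular_doubling "inv_gorder L" T by (rule dual_modular_doubling)
  obtain y k where qy: "q = (y, k)" by fastforce
  with q have y: "y \<in> carrier L" and k: "k = 0 \<or> k = 1" by auto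
  have c: "x \<squnion> y \<in> carrier L" "x \<sqinter> y \<in> carrier L" using x y by auto
  have upper: "doubled_le (x, 1) u" if "doubled_le (x, 0) u" "doubled_le q u" for u
  proof -
    have uc: "u \<in> carrier L \<times> {0, 1}" using that by (cases u) (auto simp: doubled_le_def)
    have "doubled_le ((x, 1) \<squnion>\<^bsub>doubled L T\<^esub> q) u"
      using D.join_le[of "(x, 0)" u q] that uc x q by (simp add: j)
    moreover have "doubled_le (x, 1) ((x, 1) \<squnion>\<^bsub>doubled L T\<^esub> q)"
      using D.join_left[of "(x, 1)" q] x q by simp
    ultimately show ?thesis by (blast intro: doubled_le_trans)
  qed
  have lower: "doubled_le l (x, 0)" if "doubled_le l (x, 1)" "doubled_le l q" for l
  proof -
    have lc: "l \<in> carrier L \<times> {0, 1}" using that by (cases l) (auto simp: doubled_le_def)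
    have "doubled_le l ((x, 0) \<sqinter>\<^bsub>doubled L T\<^esub> q)"
      using D.meet_le[of l "(x, 1)" q] that lc x q by (simp add: m)
    moreover have "doubled_le ((x, 0) \<sqinter>\<^bsub>doubled L T\<^esub> q) (x, 0)"
      using D.meet_left[of "(x, 0)" q] x q by simp
    ultimately show ?thesis by (blast intro: doubled_le_trans)
  qed
  note lat = join_left join_right meet_left meet_right
  from k show False
  proof
    assume "k = 1"
    then have "ascends L T (x \<sqinter> y) x"
      using lower[of "(x \<sqinter> y, 1)"] c x y by (simp add: qy doubled_le_def lat)
    then have up: "ascends L T y (x \<squnion> y)" using x y by (rule ascends_transpose_up)
    then have "ascends L T x (x \<squnion> y)"
      using upper[of "(x \<squnion> y, 0)"] c x y \<open>k = 1\<close> by (simp add: qy doubled_le_def lat)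
    then show False using not_ascends_both[OF x y] up by blast
  next
    assume "k = 0"
    then have "ascends L T x (x \<squnion> y)"
      using upper[of "(x \<squnion> y, 0)"] c x y by (simp add: qy doubled_le_def lat)
    then have dn: "ascends L T (x \<sqinter> y) y"
      using dual.ascends_transpose_up[of x y] x y by simp
    then have "ascends L T (x \<sqinter> y) x"
      using lower[of "(x \<sqinter> y, 1)"] c x y \<open>k = 0\<close> by (simp add: qy doubled_le_def lat)
    then show False using dual.not_ascends_both[of x y] x y dn by simp
  qed
qed

lemma doubled_cancel:
  assumes "p \<in> carrier L \<times> {0, 1}" "q \<in> carrier L \<times> {0, 1}" "r \<in> carrier L \<times> {0, 1}"
    and "p \<squnion>\<^bsub>doubled L T\<^esub> q = r \<squnion>\<^bsub>doubled L T\<^esub> q" "p \<sqinter>\<^bsub>doubled L T\<^esub> q = r \<sqinter>\<^bsub>doubled L T\<^esub> q"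
    and "fst p = fst r"
  shows "p = r"
proof -
  obtain x i k where pr: "p = (x, i)" "r = (x, k)"
    using assms(6) by (cases p; cases r) simp
  then have "x \<in> carrier L" "i = 0 \<or> i = 1" "k = 0 \<or> k = 1"
    using assms(1,3) by simp_all
  then show ?thesis
    using assms(2,4,5) fibre_cancel[of x q] by (elim disjE) (simp_all add: pr)
qed

lemma modular_doubled: "modular_lattice (doubled L T)"
proof (rule lattice.modular_latticeI[OF lattice_doubled])
  fix p q r
  assume "p \<in> carrier (doubled L T)" "q \<in> carrier (doubled L T)" "r \<in> carrier (doubled L T)"
    and le: "p \<sqsubseteq>\<^bsub>doubled L T\<^esub> r"
    and eq: "p \<squnion>\<^bsub>doubled L T\<^esub> q = r \<squnion>\<^bsub>doubled L T\<^esub> q" "p \<sqinter>\<^bsub>doubled L T\<^esub> q = r \<sqinter>\<^bsub>doubled L T\<^esub> q"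
  then have c: "p \<in> carrier L \<times> {0, 1}" "q \<in> carrier L \<times> {0, 1}" "r \<in> carrier L \<times> {0, 1}"
    by simp_all
  have "fst p = fst r"
    using modular_cancel[of "fst p" "fst q" "fst r"] le fst_doubled[OF c(1,2)] fst_doubled[OF c(3,2)] c eq
    by (simp add: doubled_le_def mem_Times_iff)
  then show "p = r" by (rule doubled_cancel[OF c eq])
qed

lemma distributive_doubled:
  assumes "distributive_lattice L"
  shows "distributive_lattice (doubled L T)"
proof (rule modular_lattice.distributive_latticeI[OF modular_doubled])
  fix p q r
  assume "p \<in> carrier (doubled L T)" "q \<in> carrier (doubled L T)" "r \<in> carrier (doubled L T)"
    and eq: "p \<squnion>\<^bsub>doubled L T\<^esub> q = r \<squnion>\<^bsub>doubled L T\<^esub> q" "p \<sqinter>\<^bsub>doubled L T\<^esub> q = r \<sqinter>\<^bsub>doubled L T\<^esub> q"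
  then have c: "p \<in> carrier L \<times> {0, 1}" "q \<in> carrier L \<times> {0, 1}" "r \<in> carrier L \<times> {0, 1}"
    by simp_all
  have "fst p = fst r"
    using distributive_lattice.distributive_cancel[OF assms, of "fst p" "fst q" "fst r"]
      fst_doubled[OF c(1,2)] fst_doubled[OF c(3,2)] c eq
    by (simp add: mem_Times_iff)
  then show "p = r" by (rule doubled_cancel[OF c eq])
qed

text \<open>
  A chain projects to a chain of \<open>L\<close>, and the fibres of the projection have two elements.
\<close>

lemma finite_length_doubled:
  assumes "finite_length L"
  shows "finite_length (doubled L T)"
proof -
  obtain n where n: "\<And>C. \<lbrakk>C \<subseteq> carrier L; Complete_Partial_Order.chain (le L) C\<rbrakk>
      \<Longrightarrow> finite C \<and> card C \<le> n + 1"
    using assms unfolding finite_length_def by metis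
  have "finite C \<and> card C \<le> (2 * n + 1) + 1"
    if C: "C \<subseteq> carrier (doubled L T)" "Complete_Partial_Order.chain (le (doubled L T)) C" for C
  proof -
    have total: "doubled_le p q \<or> doubled_le q p" if "p \<in> C" "q \<in> C" for p q
      using C(2) that by (simp add: chain_def)
    have chain: "Complete_Partial_Order.chain (le L) (fst ` C)"
    proof (rule chainI)
      fix a b assume "a \<in> fst ` C" "b \<in> fst ` C"
      then obtain p q where "p \<in> C" "q \<in> C" "a = fst p" "b = fst q" by blast
      then show "a \<sqsubseteq> b \<or> b \<sqsubseteq> a" using total[of p q] by (auto simp only: doubled_le_def)
    qed
    have sub: "C \<subseteq> fst ` C \<times> {0, 1}"
    proof
      fix p assume "p \<in> C"
      then show "p \<in> fst ` C \<times> {0, 1}" using subsetD[OF C(1)] by (simp add: mem_Times_iff)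
    qed
    have "fst ` C \<subseteq> carrier L" using image_mono[OF C(1), of fst] by simp
    then have fin: "finite (fst ` C)" "card (fst ` C) \<le> n + 1" using n chain by simp_all
    have "card (fst ` C \<times> {0, 1 :: nat}) \<le> (n + 1) * 2"
      using fin by (simp add: card_cartesian_product)
    moreover have "finite (fst ` C \<times> {0, 1 :: nat})" using fin(1) by simp
    ultimately show ?thesis using card_mono[OF _ sub] finite_subset[OF sub] by simp
  qed
  then show ?thesis unfolding finite_length_def by (intro exI[of _ "2 * n + 1"]) simp
qed

end

theorem theorem2p1:
  fixes L :: "('a, 'm) gorder_scheme"
    and T :: "('a \<times> 'a) set"
  assumes "modular_lattice L"
    and "finite_length L"
    and "doubling_tolerance L T"
  shows "modular_lattice (doubled L T) \<and> finite_length (doubled L T) \<and>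
    (distributive_lattice L \<longrightarrow> distributive_lattice (doubled L T))"
proof -
  interpret modular_doubling L T
    using assms(1,3) by (simp add: modular_doubling_def modular_doubling_axioms_def)
  show ?thesis
    using modular_doubled distributive_doubled finite_length_doubled[OF assms(2)] by blast
qed

end
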